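(* Let $n \geq 1$ be an integer and let $m_3(n)$ denote the minimum size of a good placement of queens on the $n \times n$ board $B_n$. If $n \not\equiv 3 \pmod 4$, then $m_3(n) \geq n$. If $n \equiv 3 \pmod 4$, then $m_3(n) \geq n-1$.
   Context: Let $B_n = \{1,\ldots,n\} \times \{1,\ldots,n\} \subset \mathbb{Z}^2$; its elements are called squares. A line means a straight line in the plane of slope $0$, $+1$, $-1$ or $\infty$ containing points of $\mathbb{Z}^2$ (that is, a row, a column, or a diagonal in either of the two diagonal directions). A placement (of queens) on $B_n$ is a subset $\mathcal{Q} \subseteq B_n$; its elements are the occupied squares (queens), and its size is $|\mathcal{Q}|$. Three queens are in a line if the three distinct squares they occupy all lie on one common line in this sense (they need not be adjacent or consecutive, and other queens do not block). A placement $\mathcal{Q}$ on $B_n$ is good if it contains no three queens in a line, and for every unoccupied square $p \in B_n \setminus \mathcal{Q}$ the placement $\mathcal{Q} \cup \{p\}$ contains three queens in a line. *)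

theory Defs
  imports Main
begin

definition board :: "nat \<Rightarrow> (int \<times> int) set" where
  "board n = {1..int n} \<times> {1..int n}"

text \<open>A line is represented by the set of its lattice points. A line of slope
  0, infinity, 1 or -1 that contains a lattice point has the respective equation
  \<open>y = c\<close>, \<open>x = c\<close>, \<open>y - x = c\<close> or \<open>x + y = c\<close> with an integer \<open>c\<close>.\<close>

definition queen_line :: "(int \<times> int) set \<Rightarrow> bool" where
  "queen_line L \<longleftrightarrow>
     (\<exists>c. L = {(x, y). y = c} \<or> L = {(x, y). x = c} \<or>
          L = {(x, y). y - x = c} \<or> L = {(x, y). x + y = c})"

definition has_three_in_line :: "(int \<times> int) set \<Rightarrow> bool" where
  "has_three_in_line Q \<longleftrightarrow>
     (\<exists>L p q r. queen_line L \<and> p \<noteq> q \<and> p \<noteq> r \<and> q \<noteq> r \<and> {p, q, r} \<subseteq> Q \<inter> L)"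

definition good_placement :: "nat \<Rightarrow> (int \<times> int) set \<Rightarrow> bool" where
  "good_placement n Q \<longleftrightarrow>
     Q \<subseteq> board n \<and> \<not> has_three_in_line Q \<and>
     (\<forall>p \<in> board n - Q. has_three_in_line (insert p Q))"

definition m3 :: "nat \<Rightarrow> nat" where
  "m3 n = Min {card Q | Q. good_placement n Q}"

end

theory Submission
  imports Defs "HOL-Computational_Algebra.Polynomial"
begin

text \<open>
  Let \<open>Q\<close> be good with \<open>q\<close> queens. A square blocks a further queen only if it lies on a
  line that already holds two queens. In each of the four directions these full lines are
  disjoint, so there are at most \<open>q / 2\<close> of them. They cover all unoccupied squares. A queen
  on no full line is wasted for all four counts; cover half of these queens by their columns
  and half by their rows. The whole board is then covered by four families of
  parallel lines, of about \<open>q / 2\<close> lines each (lemma \<open>good_placement_cover\<close>).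

  Such a cover is impossible if the lines are few (lemma \<open>uncovered_square\<close>). The product
  \<open>f\<close> of the equations of the lines vanishes on the board. With \<open>\<alpha>\<close> columns,
  \<open>\<beta>\<close> rows and \<open>m\<close> diagonals of each kind, the homogeneous part of
  highest degree of \<open>f\<close> is \<open>x^\<alpha> y^\<beta> (y\<^sup>2 - x\<^sup>2)^m\<close>. It contains the monomial
  with exponents \<open>\<alpha> + 2 k\<close> and \<open>\<beta> + 2 (m - k)\<close> with the coefficient
  \<open>(-1)^k (m choose k) \<noteq> 0\<close>, for every \<open>k \<le> m\<close>. By the Combinatorial Nullstellensatz
  \<open>f\<close> cannot vanish on a grid with one more column and one more row than these exponents.
  If \<open>q\<close> is too small, some \<open>k\<close> makes both exponents smaller than \<open>n\<close>,
  a contradiction.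

  The residue of \<open>n\<close> modulo 4 matters because only even powers of \<open>x\<close> and \<open>y\<close>
  occur in \<open>(y\<^sup>2 - x\<^sup>2)^m\<close>. If \<open>q = n - 1 = 2 m\<close> and all four families have
  \<open>m\<close> lines, both exponents must be \<open>2 m\<close>, hence \<open>k = m / 2\<close>: this works for
  \<open>n\<close> congruent to 1 and fails for \<open>n\<close> congruent to 3 modulo 4, where the
  argument excludes only \<open>q \<le> n - 2\<close>.

  The instance of the Nullstellensatz for a product of linear forms is proved with finite
  differences (lemma \<open>nonzero_on_grid\<close>): the mixed difference of orders \<open>a\<close> and
  \<open>b\<close> sees only the values on an \<open>a + 1\<close> by \<open>b + 1\<close> grid, and it sends a
  polynomial of degree \<open>a + b\<close> to \<open>a! b!\<close> times its coefficient of \<open>x^a y^b\<close>.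
\<close>

section \<open>Mixed finite differences of products of linear forms\<close>

definition diff_x :: "(int \<Rightarrow> int \<Rightarrow> int) \<Rightarrow> int \<Rightarrow> int \<Rightarrow> int" where
  "diff_x f x y = f (x + 1) y - f x y"

definition diff_y :: "(int \<Rightarrow> int \<Rightarrow> int) \<Rightarrow> int \<Rightarrow> int \<Rightarrow> int" where
  "diff_y f x y = f x (y + 1) - f x y"

definition mixed_diff :: "nat \<Rightarrow> nat \<Rightarrow> (int \<Rightarrow> int \<Rightarrow> int) \<Rightarrow> int \<Rightarrow> int \<Rightarrow> int" where
  "mixed_diff a b f = (diff_x ^^ a) ((diff_y ^^ b) f)"

lemma diff_x_Suc: "(diff_x ^^ Suc a) f x y = (diff_x ^^ a) f (x + 1) y - (diff_x ^^ a) f x y"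
  unfolding funpow.simps o_apply by (rule diff_x_def)

lemma diff_y_Suc: "(diff_y ^^ Suc b) f x y = (diff_y ^^ b) f x (y + 1) - (diff_y ^^ b) f x y"
  unfolding funpow.simps o_apply by (rule diff_y_def)

lemma diff_x_add: "(diff_x ^^ a) (\<lambda>x y. f x y + g x y)
    = (\<lambda>x y. (diff_x ^^ a) f x y + (diff_x ^^ a) g x y)"
proof (induction a)
  case (Suc a)
  show ?case
    by (intro ext) (simp add: Suc.IH diff_x_Suc del: funpow.simps(2))
qed simp

lemma diff_y_add: "(diff_y ^^ b) (\<lambda>x y. f x y + g x y)
    = (\<lambda>x y. (diff_y ^^ b) f x y + (diff_y ^^ b) g x y)"
proof (induction b)
  case (Suc b)
  show ?case
    by (intro ext) (simp add: Suc.IH diff_y_Suc del: funpow.simps(2))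
qed simp

lemma diff_x_mult: "(diff_x ^^ a) (\<lambda>x y. g y * f x y) = (\<lambda>x y. g y * (diff_x ^^ a) f x y)"
proof (induction a)
  case (Suc a)
  show ?case
    by (intro ext) (simp add: Suc.IH diff_x_Suc algebra_simps del: funpow.simps(2))
qed simp

lemma diff_y_mult: "(diff_y ^^ b) (\<lambda>x y. g x * f x y) = (\<lambda>x y. g x * (diff_y ^^ b) f x y)"
proof (induction b)
  case (Suc b)
  show ?case
    by (intro ext) (simp add: Suc.IH diff_y_Suc algebra_simps del: funpow.simps(2))
qed simp

lemma diff_x_shift_y: "(diff_x ^^ a) (\<lambda>x y. f x (y + 1)) = (\<lambda>x y. (diff_x ^^ a) f x (y + 1))"
proof (induction a)
  case (Suc a)
  show ?case
    by (intro ext) (simp add: Suc.IH diff_x_Suc del: funpow.simps(2))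
qed simp

text \<open>The discrete Leibniz rule for \<open>x\<close>. The truncated order \<open>a - 1\<close> is harmless:
  for \<open>a = 0\<close> the term is multiplied by 0.\<close>

lemma diff_x_times_x:
  "(diff_x ^^ a) (\<lambda>x y. x * f x y)
    = (\<lambda>x y. x * (diff_x ^^ a) f x y + int a * (diff_x ^^ (a - 1)) f (x + 1) y)"
proof (induction a)
  case (Suc a)
  show ?case
    by (intro ext, simp only: diff_x_Suc Suc.IH, cases a)
      (simp_all add: diff_x_Suc algebra_simps del: funpow.simps(2))
qed simp

lemma diff_y_times_y:
  "(diff_y ^^ b) (\<lambda>x y. y * f x y)
    = (\<lambda>x y. y * (diff_y ^^ b) f x y + int b * (diff_y ^^ (b - 1)) f x (y + 1))"
proof (induction b)
  case (Suc b)
  show ?case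
    by (intro ext, simp only: diff_y_Suc Suc.IH, cases b)
      (simp_all add: diff_y_Suc algebra_simps del: funpow.simps(2))
qed simp

lemma mixed_diff_add: "mixed_diff a b (\<lambda>x y. f x y + g x y) s t
    = mixed_diff a b f s t + mixed_diff a b g s t"
  by (simp add: mixed_diff_def diff_x_add diff_y_add)

lemma mixed_diff_cmult: "mixed_diff a b (\<lambda>x y. c * f x y) s t = c * mixed_diff a b f s t"
  by (simp add: mixed_diff_def diff_x_mult diff_y_mult)

lemma mixed_diff_times_x:
  "mixed_diff a b (\<lambda>x y. x * f x y) s t
    = s * mixed_diff a b f s t + int a * mixed_diff (a - 1) b f (s + 1) t"
  by (simp add: mixed_diff_def diff_x_times_x diff_y_mult)

lemma mixed_diff_times_y:
  "mixed_diff a b (\<lambda>x y. y * f x y) s t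
    = t * mixed_diff a b f s t + int b * mixed_diff a (b - 1) f s (t + 1)"
  by (simp add: mixed_diff_def diff_y_times_y diff_x_add diff_x_mult diff_x_shift_y)

text \<open>Multiplying by a linear form lowers one of the two orders. This is the recursion by which
  the degree and the leading form of a product of linear forms are found factor by factor.\<close>

lemma mixed_diff_linear_form:
  "mixed_diff a b (\<lambda>x y. (u * x + v * y - c) * f x y) s t
    = (u * s + v * t - c) * mixed_diff a b f s t
      + u * int a * mixed_diff (a - 1) b f (s + 1) t
      + v * int b * mixed_diff a (b - 1) f s (t + 1)"
proof -
  have "(\<lambda>x y. (u * x + v * y - c) * f x y)
      = (\<lambda>x y. (u * (x * f x y) + v * (y * f x y)) + (- c) * f x y)"
    by (simp add: algebra_simps)
  then show ?thesis
    by (simp add: mixed_diff_add mixed_diff_cmult mixed_diff_times_x mixed_diff_times_y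
        algebra_simps del: mult_minus_left)
qed

lemma diff_x_vanishes:
  "(\<And>x. s \<le> x \<Longrightarrow> x \<le> s + int a \<Longrightarrow> f x t = 0) \<Longrightarrow> (diff_x ^^ a) f s t = 0"
proof (induction a arbitrary: s)
  case (Suc a)
  have "(diff_x ^^ a) f (s + 1) t = 0" "(diff_x ^^ a) f s t = 0"
    by (rule Suc.IH, rule Suc.prems, simp_all)+
  then show ?case by (simp add: diff_x_Suc del: funpow.simps(2))
qed simp

lemma diff_y_vanishes:
  "(\<And>y. t \<le> y \<Longrightarrow> y \<le> t + int b \<Longrightarrow> f s y = 0) \<Longrightarrow> (diff_y ^^ b) f s t = 0"
proof (induction b arbitrary: t)
  case (Suc b)
  have "(diff_y ^^ b) f s (t + 1) = 0" "(diff_y ^^ b) f s t = 0"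
    by (rule Suc.IH, rule Suc.prems, simp_all)+
  then show ?case by (simp add: diff_y_Suc del: funpow.simps(2))
qed simp

lemma mixed_diff_vanishes:
  assumes "\<And>x y. x \<in> {s..s + int a} \<Longrightarrow> y \<in> {t..t + int b} \<Longrightarrow> f x y = 0"
  shows "mixed_diff a b f s t = 0"
  unfolding mixed_diff_def
  by (intro diff_x_vanishes diff_y_vanishes) (use assms in auto)

text \<open>For a polynomial function \<open>f\<close> of degree at most \<open>d\<close>, the polynomial \<open>G\<close> is
  the homogeneous part of degree \<open>d\<close> with \<open>y\<close> set to 1: its coefficient at
  \<open>a\<close> belongs to the monomial \<open>x^a y^(d - a)\<close>. Expressing this by mixed differences
  avoids polynomials in two variables. The bound on the degree of \<open>G\<close> is what makes
  \<open>G\<close> determined by \<open>f\<close> and \<open>d\<close>, and it keeps the property stable under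
  multiplication by a linear form.\<close>

definition has_leading_form :: "nat \<Rightarrow> int poly \<Rightarrow> (int \<Rightarrow> int \<Rightarrow> int) \<Rightarrow> bool" where
  "has_leading_form d G f \<longleftrightarrow> degree G \<le> d \<and>
     (\<forall>a b s t. (d < a + b \<longrightarrow> mixed_diff a b f s t = 0) \<and>
                (a + b = d \<longrightarrow> mixed_diff a b f s t = fact a * fact b * coeff G a))"

lemma has_leading_form_one: "has_leading_form 0 1 (\<lambda>x y. 1)"
proof -
  have y: "(diff_y ^^ b) (\<lambda>x y. 1) = (\<lambda>x y. if b = 0 then 1 else 0)" for b
  proof (induction b)
    case (Suc b)
    show ?case
      by (intro ext) (simp add: Suc.IH diff_y_Suc del: funpow.simps(2))
  qed simp
  have x: "(diff_x ^^ a) (\<lambda>x y. c) = (\<lambda>x y. if a = 0 then c else 0)" for a c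
  proof (induction a)
    case (Suc a)
    show ?case
      by (intro ext) (simp add: Suc.IH diff_x_Suc del: funpow.simps(2))
  qed simp
  show ?thesis
    by (auto simp: has_leading_form_def mixed_diff_def x y)
qed

text \<open>The form \<open>u x + v y\<close> becomes \<open>u x + v\<close> when \<open>y\<close> is set to 1, and the
  constant \<open>c\<close> does not reach the top degree: in the recursion for
  mixed differences it multiplies only differences whose total order exceeds the degree of
  \<open>f\<close>.\<close>

lemma has_leading_form_mult_linear:
  assumes "has_leading_form d G f"
  shows "has_leading_form (Suc d) ([:v, u:] * G) (\<lambda>x y. (u * x + v * y - c) * f x y)"
proof -
  have deg: "degree G \<le> d"
    using assms by (simp add: has_leading_form_def)
  then have top_coeff: "coeff G (Suc d) = 0"
    by (simp add: coeff_eq_0)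
  have zero: "mixed_diff a b f s t = 0" if "d < a + b" for a b s t
    using assms that by (simp add: has_leading_form_def)
  have top: "mixed_diff a b f s t = fact a * fact b * coeff G a" if "a + b = d" for a b s t
    using assms that by (simp add: has_leading_form_def)
  show ?thesis
    unfolding has_leading_form_def mixed_diff_linear_form
  proof (intro allI conjI impI)
    show "degree ([:v, u:] * G) \<le> Suc d"
      using degree_mult_le[of "[:v, u:]" G] deg by (auto split: if_splits)
  next
    fix a b :: nat and s t :: int
    assume "Suc d < a + b"
    then show "(u * s + v * t - c) * mixed_diff a b f s t
      + u * int a * mixed_diff (a - 1) b f (s + 1) t
      + v * int b * mixed_diff a (b - 1) f s (t + 1) = 0"
      by (simp add: zero)
  next
    fix a b :: nat and s t :: int
    assume ab: "a + b = Suc d"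
    have "int a * mixed_diff (a - 1) b f (s + 1) t = fact a * fact b * coeff (pCons 0 G) a"
      using ab top[of "a - 1" b "s + 1" t] by (cases a) (auto simp: algebra_simps)
    moreover have "int b * mixed_diff a (b - 1) f s (t + 1) = fact a * fact b * coeff G a"
      using ab top[of a "b - 1" s "t + 1"] by (cases b) (auto simp: algebra_simps top_coeff)
    moreover have "coeff ([:v, u:] * G) a = v * coeff G a + u * coeff (pCons 0 G) a"
      by (cases a) simp_all
    ultimately show "(u * s + v * t - c) * mixed_diff a b f s t
      + u * int a * mixed_diff (a - 1) b f (s + 1) t
      + v * int b * mixed_diff a (b - 1) f s (t + 1) = fact a * fact b * coeff ([:v, u:] * G) a"
      using zero[of a b s t] ab
      by (simp add: mult.assoc del: mult_pCons_left) (simp add: algebra_simps)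
  qed
qed

lemma has_leading_form_prod_linear:
  assumes "has_leading_form d G f" "finite C"
  shows "has_leading_form (d + card C) ([:v, u:] ^ card C * G)
           (\<lambda>x y. (\<Prod>c\<in>C. u * x + v * y - c) * f x y)"
  using assms(2)
proof (induction C)
  case empty
  then show ?case using assms(1) by simp
next
  case (insert c C)
  from has_leading_form_mult_linear[OF insert.IH, of v u c] insert.hyps show ?case
    by (simp only: card_insert_disjoint prod.insert power_Suc add_Suc_right mult.assoc not_False_eq_True)
qed

text \<open>The Combinatorial Nullstellensatz for intervals: if \<open>f\<close> vanished on the grid, so would
  the mixed difference that extracts the coefficient.\<close>

lemma nonzero_on_grid:
  assumes "has_leading_form (a + b) G f" "coeff G a \<noteq> 0"
  shows "\<exists>x\<in>{s..s + int a}. \<exists>y\<in>{t..t + int b}. f x y \<noteq> 0"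
proof (rule ccontr)
  assume "\<not> ?thesis"
  then have "mixed_diff a b f s t = 0"
    by (intro mixed_diff_vanishes) blast
  with assms show False
    by (simp add: has_leading_form_def)
qed

lemma coeff_difference_of_squares_power:
  "coeff ([:1, 0, - 1:] ^ m) (2 * k) = (- 1 :: int) ^ k * int (m choose k)"
proof (induction m arbitrary: k)
  case 0
  then show ?case by (cases k) auto
next
  case (Suc m)
  have "coeff ([:1, 0, - 1:] ^ m) 0 = (1 :: int)"
    using Suc.IH[of 0] by simp
  moreover have "coeff ([:1, 0, - 1:] ^ m) (Suc (Suc (2 * j))) = (- 1 :: int) ^ Suc j * int (m choose Suc j)" for j
    using Suc.IH[of "Suc j"] by simp
  ultimately show ?case
    by (cases k) (simp_all add: Suc.IH distrib_left)
qed

section \<open>Few lines do not cover a grid\<close>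

lemma exists_superset_of_card:
  assumes "finite A" "card A \<le> k"
  shows "\<exists>B :: int set. A \<subseteq> B \<and> finite B \<and> card B = k"
proof -
  have "infinite (- A)"
    using assms(1) by (simp add: Compl_eq_Diff_UNIV infinite_UNIV_int)
  then obtain E where E: "finite E" "card E = k - card A" "E \<subseteq> - A"
    using infinite_arbitrarily_large by blast
  then have "card (A \<union> E) = k"
    using assms by (subst card_Un_disjoint) auto
  then show ?thesis
    using assms(1) E(1) by blast
qed

text \<open>The parameter \<open>k\<close> selects the monomial \<open>x^(2 k) y^(2 (m - k))\<close> of
  \<open>(y\<^sup>2 - x\<^sup>2)^m\<close>; different choices give grids of different shapes. Both
  diagonal families have the same bound \<open>m\<close> so that their leading forms combine to
  this power, whose coefficients are binomial.\<close>

lemma uncovered_square: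
  fixes A B C D :: "int set"
  assumes fin: "finite A" "finite B" "finite C" "finite D"
    and card: "card A \<le> \<alpha>" "card B \<le> \<beta>" "card C \<le> m" "card D \<le> m"
    and "k \<le> m"
  shows "\<exists>x\<in>{s..s + int (\<alpha> + 2 * k)}. \<exists>y\<in>{t..t + int (\<beta> + 2 * (m - k))}.
           x \<notin> A \<and> y \<notin> B \<and> y - x \<notin> C \<and> x + y \<notin> D"
proof -
  \<comment> \<open>Adding lines makes every family exactly as large as its bound, which fixes the
    leading form.\<close>
  obtain A' where A': "A \<subseteq> A'" "finite A'" "card A' = \<alpha>"
    using exists_superset_of_card[OF fin(1) card(1)] by blast
  obtain B' where B': "B \<subseteq> B'" "finite B'" "card B' = \<beta>"
    using exists_superset_of_card[OF fin(2) card(2)] by blast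
  obtain C' where C': "C \<subseteq> C'" "finite C'" "card C' = m"
    using exists_superset_of_card[OF fin(3) card(3)] by blast
  obtain D' where D': "D \<subseteq> D'" "finite D'" "card D' = m"
    using exists_superset_of_card[OF fin(4) card(4)] by blast
  define f where "f x y = (\<Prod>c\<in>A'. 1 * x + 0 * y - c) * ((\<Prod>c\<in>B'. 0 * x + 1 * y - c) *
      ((\<Prod>c\<in>C'. (- 1) * x + 1 * y - c) * ((\<Prod>c\<in>D'. 1 * x + 1 * y - c) * 1)))" for x y
  define G :: "int poly" where
    "G = [:0, 1:] ^ \<alpha> * ([:1, 0:] ^ \<beta> * ([:1, - 1:] ^ m * ([:1, 1:] ^ m * 1)))"
  have "has_leading_form (0 + card D' + card C' + card B' + card A')
      ([:0, 1:] ^ card A' * ([:1, 0:] ^ card B' * ([:1, - 1:] ^ card C' * ([:1, 1:] ^ card D' * 1)))) f"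
    unfolding f_def
    by (intro has_leading_form_prod_linear has_leading_form_one A'(2) B'(2) C'(2) D'(2))
  moreover have "0 + m + m + \<beta> + \<alpha> = \<alpha> + 2 * k + (\<beta> + 2 * (m - k))"
    using \<open>k \<le> m\<close> by simp
  ultimately have form: "has_leading_form (\<alpha> + 2 * k + (\<beta> + 2 * (m - k))) G f"
    by (simp only: A' B' C' D' G_def)
  have "[:1, - 1:] * [:1, 1:] = ([:1, 0, - 1:] :: int poly)"
    by simp
  then have "G = monom 1 \<alpha> * [:1, 0, - 1:] ^ m"
    by (simp add: G_def monom_altdef one_pCons[symmetric] flip: power_mult_distrib)
  then have "coeff G (\<alpha> + 2 * k) = (- 1) ^ k * int (m choose k)"
    by (simp add: coeff_monom_mult coeff_difference_of_squares_power)
  then have "coeff G (\<alpha> + 2 * k) \<noteq> 0"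
    using \<open>k \<le> m\<close> by simp
  from nonzero_on_grid[OF form this, of s t] obtain x y
    where xy: "x \<in> {s..s + int (\<alpha> + 2 * k)}" "y \<in> {t..t + int (\<beta> + 2 * (m - k))}" "f x y \<noteq> 0"
    by blast
  then have "x \<notin> A'" "y \<notin> B'" "y - x \<notin> C'" "x + y \<notin> D'"
    using A'(2) B'(2) C'(2) D'(2) by (auto simp: f_def)
  with xy A' B' C' D' show ?thesis
    by blast
qed

section \<open>Good placements cover the board by few lines\<close>

text \<open>The level sets of \<open>x\<close>, \<open>y\<close>, \<open>y - x\<close> and \<open>x + y\<close> are the queen lines of the four
  directions, so one notion with \<open>f\<close> as a parameter serves all of them.\<close>

definition full_levels :: "('a \<Rightarrow> int) \<Rightarrow> 'a set \<Rightarrow> int set" where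
  "full_levels f Q = {c. 2 \<le> card {p \<in> Q. f p = c}}"

lemma full_levels_subset: "full_levels f Q \<subseteq> f ` Q"
proof
  fix c assume "c \<in> full_levels f Q"
  then have "{p \<in> Q. f p = c} \<noteq> {}"
    unfolding full_levels_def by force
  then show "c \<in> f ` Q" by blast
qed

lemma full_level_if_two:
  assumes "finite Q" "q \<in> Q" "r \<in> Q" "q \<noteq> r" "f q = c" "f r = c"
  shows "c \<in> full_levels f Q"
proof -
  have "card {q, r} \<le> card {p \<in> Q. f p = c}"
    using assms by (intro card_mono) auto
  then show ?thesis
    using assms(4) by (simp add: full_levels_def)
qed

text \<open>The full lines of one direction are disjoint and each uses up two queens outside
  \<open>U\<close>.\<close>

lemma card_full_levels:
  assumes "finite Q" "U \<subseteq> Q" "\<And>p. p \<in> U \<Longrightarrow> f p \<notin> full_levels f Q"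
  shows "2 * card (full_levels f Q) \<le> card Q - card U"
proof -
  have fin: "finite (full_levels f Q)"
    using assms(1) full_levels_subset finite_subset by fast
  have "2 * card (full_levels f Q) = (\<Sum>c\<in>full_levels f Q. 2)"
    by simp
  also have "\<dots> \<le> (\<Sum>c\<in>full_levels f Q. card {p \<in> Q. f p = c})"
    by (intro sum_mono) (simp add: full_levels_def)
  also have "\<dots> = card (\<Union>c\<in>full_levels f Q. {p \<in> Q. f p = c})"
    using assms(1) fin by (intro card_UN_disjoint[symmetric]) auto
  also have "\<dots> \<le> card (Q - U)"
    using assms by (intro card_mono) auto
  also have "\<dots> = card Q - card U"
    using assms by (intro card_Diff_subset) (auto intro: finite_subset)
  finally show ?thesis .
qed

lemma card_Un_image_le:
  assumes "finite S"
  shows "card (V \<union> f ` S) \<le> card V + card S"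
  using card_Un_le[of V "f ` S"] card_image_le[OF assms, of f] by linarith

lemma finite_good_placement: "good_placement n Q \<Longrightarrow> finite Q"
  by (rule finite_subset[of _ "board n"]) (simp_all add: good_placement_def board_def)

text \<open>Since \<open>Q\<close> itself has no three queens in a line, the new queen is one of the three, and the
  other two make its line full.\<close>

lemma unoccupied_on_full_line:
  assumes "good_placement n Q" "(x, y) \<in> board n - Q"
  shows "x \<in> full_levels fst Q \<or> y \<in> full_levels snd Q \<or>
         y - x \<in> full_levels (\<lambda>(x, y). y - x) Q \<or> x + y \<in> full_levels (\<lambda>(x, y). x + y) Q"
proof -
  have fin: "finite Q" by (rule finite_good_placement[OF assms(1)])
  have no: "\<not> has_three_in_line Q" and "has_three_in_line (insert (x, y) Q)"
    using assms by (auto simp: good_placement_def)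
  then obtain L p q r where L: "queen_line L" and pqr: "p \<noteq> q" "p \<noteq> r" "q \<noteq> r"
    "{p, q, r} \<subseteq> insert (x, y) Q \<inter> L"
    unfolding has_three_in_line_def by blast
  have conclusion: ?thesis if "(x, y) \<in> L" "a \<in> Q" "a \<in> L" "b \<in> Q" "b \<in> L" "a \<noteq> b" for a b
  proof -
    have "\<exists>c. \<exists>f\<in>{snd, fst, \<lambda>(x, y). y - x, \<lambda>(x, y). x + y}. L = {p. f p = c}"
      using L by (simp add: queen_line_def case_prod_unfold)
    then obtain f c where f: "f \<in> {snd, fst, \<lambda>(x, y). y - x, \<lambda>(x, y). x + y}"
      and "L = {p. f p = c}"
      by blast
    then have "f (x, y) \<in> full_levels f Q"
      using full_level_if_two[OF fin that(2,4,6), of f c] that by simp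
    then show ?thesis using f by auto
  qed
  have "\<not> (p \<in> Q \<and> q \<in> Q \<and> r \<in> Q)"
    using no L pqr unfolding has_three_in_line_def by blast
  then consider "p = (x, y)" "q \<in> Q" "r \<in> Q" | "q = (x, y)" "p \<in> Q" "r \<in> Q"
    | "r = (x, y)" "p \<in> Q" "q \<in> Q"
    using pqr by auto
  then show ?thesis
    using pqr conclusion by cases auto
qed

text \<open>The set \<open>U\<close> in the proof consists of the queens on no full line. Each of them
  lowers the bound on twice the number of full lines by 1 in every direction. A column or
  row added for it raises twice the size of one family by 2, so this family has room
  for one added line per two such queens: half of \<open>U\<close> is covered by columns, half by rows. If \<open>U\<close> has an odd number of
  elements, the columns take the extra one; this is the \<open>+ 1\<close> in the bound for
  \<open>A\<close>.\<close>

lemma good_placement_cover: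
  assumes "good_placement n Q"
  obtains A B C D :: "int set"
  where "finite A" "finite B" "finite C" "finite D"
    and "2 * card A \<le> card Q + 1" "2 * card B \<le> card Q" "2 * card C \<le> card Q" "2 * card D \<le> card Q"
    and "\<And>x y. (x, y) \<in> board n \<Longrightarrow> x \<in> A \<or> y \<in> B \<or> y - x \<in> C \<or> x + y \<in> D"
proof -
  let ?d = "\<lambda>(x, y). y - x :: int" and ?e = "\<lambda>(x, y). x + y :: int"
  define U where "U = {p \<in> Q. fst p \<notin> full_levels fst Q \<and> snd p \<notin> full_levels snd Q \<and>
    ?d p \<notin> full_levels ?d Q \<and> ?e p \<notin> full_levels ?e Q}"
  have fin: "finite Q" by (rule finite_good_placement[OF assms])
  have U: "U \<subseteq> Q" "finite U" using fin by (auto simp: U_def)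
  obtain S where S: "S \<subseteq> U" "card S = card U div 2"
    using obtain_subset_with_card_n[of "card U div 2" U] by auto
  have fS: "finite S" using S U finite_subset by blast
  have cUS: "card (U - S) = card U - card U div 2"
    using S fS by (simp add: card_Diff_subset)
  have cU: "card U \<le> card Q" using U fin by (simp add: card_mono)
  have levels: "2 * card (full_levels f Q) \<le> card Q - card U"
    if "f = fst \<or> f = snd \<or> f = ?d \<or> f = ?e" for f
    using that by (intro card_full_levels[OF fin U(1)]) (auto simp: U_def)
  have finl: "finite (full_levels f Q)" for f :: "int \<times> int \<Rightarrow> int"
    using fin full_levels_subset finite_subset by fast
  show ?thesis
  proof (rule that[of "full_levels fst Q \<union> fst ` (U - S)" "full_levels snd Q \<union> snd ` S"
        "full_levels ?d Q" "full_levels ?e Q"])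
    show "2 * card (full_levels fst Q \<union> fst ` (U - S)) \<le> card Q + 1"
      using card_Un_image_le[of "U - S" "full_levels fst Q" fst] levels[of fst] cUS cU U by simp
    show "2 * card (full_levels snd Q \<union> snd ` S) \<le> card Q"
      using card_Un_image_le[OF fS, of "full_levels snd Q" snd] levels[of snd] S(2) cU by simp
    show "2 * card (full_levels ?d Q) \<le> card Q" using levels[of ?d] by simp
    show "2 * card (full_levels ?e Q) \<le> card Q" using levels[of ?e] by simp
    fix x y assume xy: "(x, y) \<in> board n"
    show "x \<in> full_levels fst Q \<union> fst ` (U - S) \<or> y \<in> full_levels snd Q \<union> snd ` S \<or>
       y - x \<in> full_levels ?d Q \<or> x + y \<in> full_levels ?e Q"
    proof (cases "(x, y) \<in> Q")
      case True
      then show ?thesis by (cases "(x, y) \<in> S") (force simp: U_def)+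
    next
      case False
      then show ?thesis using unoccupied_on_full_line[OF assms] xy by blast
    qed
  qed (use finl U fS in auto)
qed

section \<open>The lower bound\<close>

text \<open>The grid that the covering lines cannot cover fits into the board, by the
  last two hypotheses, although these lines cover the whole board.\<close>

lemma no_good_placement_if_grid_fits:
  assumes "good_placement n Q" "card Q \<le> 2 * \<alpha>" "card Q \<le> 2 * m + 1" "k \<le> m"
    "\<alpha> + 2 * k < n" "m + 2 * (m - k) < n"
  shows False
proof -
  obtain A B C D :: "int set"
  where cover: "finite A" "finite B" "finite C" "finite D"
    "2 * card A \<le> card Q + 1" "2 * card B \<le> card Q" "2 * card C \<le> card Q" "2 * card D \<le> card Q"
    "\<And>x y. (x, y) \<in> board n \<Longrightarrow> x \<in> A \<or> y \<in> B \<or> y - x \<in> C \<or> x + y \<in> D"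
    by (rule good_placement_cover[OF assms(1)]) (rule that)
  have "card A \<le> \<alpha>" "card B \<le> m" "card C \<le> m" "card D \<le> m"
    using cover(5-8) assms(2,3) by linarith+
  from uncovered_square[OF cover(1-4) this assms(4), of 1 1]
  obtain x y where xy: "x \<in> {1..1 + int (\<alpha> + 2 * k)}" "y \<in> {1..1 + int (m + 2 * (m - k))}"
    "x \<notin> A \<and> y \<notin> B \<and> y - x \<notin> C \<and> x + y \<notin> D"
    by blast
  then have "(x, y) \<in> board n"
    using assms(5,6) unfolding board_def by simp
  with cover(9) xy(3) show False by blast
qed

text \<open>With \<open>j = n div 4\<close>, the choices below put the exponents \<open>\<alpha> + 2 k\<close> and
  \<open>m + 2 (m - k)\<close> at \<open>(4 j - 2, 4 j - 1)\<close>, \<open>(4 j, 4 j)\<close>,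
  \<open>(4 j + 1, 4 j)\<close> and again \<open>(4 j + 1, 4 j)\<close> for the residues 0, 1, 2 and 3. For an
  odd number of queens there may be one column more than lines in the other directions, and
  this column gives the two exponents different parities.\<close>

lemma card_good_placement:
  assumes "good_placement n Q" "n \<ge> 1"
  shows "(if n mod 4 = 3 then n - 1 else n) \<le> card Q"
proof (rule ccontr)
  assume less: "\<not> ?thesis"
  define j where "j = n div 4"
  have "n mod 4 < 4" by simp
  then consider "n mod 4 = 0" | "n mod 4 = 1" | "n mod 4 = 2" | "n mod 4 = 3" by linarith
  then show False
  proof cases
    case 1
    then have "n = 4 * j + 0"
      unfolding j_def by presburger
    moreover from this have "card Q + 1 \<le> n"
      using less \<open>n mod 4 = 0\<close> by simp
    moreover have "j \<ge> 1"
      using calculation(1) assms(2) by linarith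
    ultimately show False
      by (intro no_good_placement_if_grid_fits[OF assms(1), of "2 * j" "2 * j - 1" "j - 1"]) simp_all
  next
    case 2
    then have "n = 4 * j + 1"
      unfolding j_def by presburger
    moreover from this have "card Q + 1 \<le> n"
      using less \<open>n mod 4 = 1\<close> by simp
    ultimately show False
      by (intro no_good_placement_if_grid_fits[OF assms(1), of "2 * j" "2 * j" "j"]) simp_all
  next
    case 3
    then have "n = 4 * j + 2"
      unfolding j_def by presburger
    moreover from this have "card Q + 1 \<le> n"
      using less \<open>n mod 4 = 2\<close> by simp
    ultimately show False
      by (intro no_good_placement_if_grid_fits[OF assms(1), of "2 * j + 1" "2 * j" "j"]) simp_all
  next
    case 4
    then have "n = 4 * j + 3"
      unfolding j_def by presburger
    moreover from this have "card Q + 1 < n"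
      using less \<open>n mod 4 = 3\<close> by simp
    ultimately show False
      by (intro no_good_placement_if_grid_fits[OF assms(1), of "2 * j + 1" "2 * j" "j"]) simp_all
  qed
qed

text \<open>The minimum of an empty set of numbers would be unspecified. A maximal placement
  without three queens in a line is good.\<close>

lemma good_placement_exists: "\<exists>Q. good_placement n Q"
proof -
  define F where "F = {Q. Q \<subseteq> board n \<and> \<not> has_three_in_line Q}"
  have "finite F"
    unfolding F_def board_def by simp
  moreover have "{} \<in> F"
    by (auto simp: F_def has_three_in_line_def)
  ultimately obtain Q where Q: "Q \<in> F" and max: "\<And>R. R \<in> F \<Longrightarrow> Q \<subseteq> R \<Longrightarrow> Q = R"
    using finite_has_maximal[of F] by blast
  have "has_three_in_line (insert p Q)" if "p \<in> board n - Q" for p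
    using max[of "insert p Q"] Q that by (auto simp: F_def)
  with Q show ?thesis
    by (auto simp: good_placement_def F_def)
qed

theorem theorem1:
  fixes n :: nat
  assumes "n \<ge> 1"
  shows "(n mod 4 \<noteq> 3 \<longrightarrow> m3 n \<ge> n) \<and> (n mod 4 = 3 \<longrightarrow> m3 n \<ge> n - 1)"
proof -
  let ?K = "{card Q | Q. good_placement n Q}"
  have "?K \<subseteq> card ` Pow (board n)"
    by (auto simp: good_placement_def)
  then have "finite ?K"
    by (rule finite_subset) (simp add: board_def)
  moreover have "?K \<noteq> {}"
    using good_placement_exists by blast
  ultimately have "m3 n \<in> ?K"
    unfolding m3_def by (rule Min_in)
  then obtain Q where "good_placement n Q" "m3 n = card Q"
    by blast
  with card_good_placement[of n Q] assms show ?thesis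
    by (auto split: if_splits)
qed

end
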